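(* Let $(G,m)$ be a finite weighted digraph with $G=(V,A,\partial)$ and in/out Laplacians $\mathcal L^{\pm}=(d^{\pm})^*d$. Then $G$ has exactly one source if and only if $0$ is a simple eigenvalue of $\mathcal L^+$, and $G$ has exactly one sink if and only if $0$ is a simple eigenvalue of $\mathcal L^-$. Moreover, the multiplicity of the eigenvalue $0$ of $\mathcal L^+$ (resp. $\mathcal L^-$) equals the number of sources (resp. sinks) of $G$.
   Context: A finite digraph $G=(V,A,\partial)$: finite disjoint sets $V$, $A$, incidence $\partial a=(\partial_-a,\partial_+a)$ (initial, terminal vertex); multiple arcs and loops allowed; weights $m\colon V\to(0,\infty)$, $m\colon A\to(0,\infty)$. $\ell_2(V,m)$, $\ell_2(A,m)$: complex functions with inner products $\sum_v\varphi(v)\overline{\psi(v)}m(v)$, $\sum_a\eta(a)\overline{\alpha(a)}m(a)$. $(d^{\pm}\varphi)(a)=\pm\varphi(\partial_{\pm}a)$, $d=d^++d^-$, and $(d^{\pm})^*$ the Hilbert adjoint; explicitly $(\mathcal L^{\pm}\varphi)(v)=\frac1{m(v)}\sum_{a\in A_v^{\pm}}(\varphi(v)-\varphi(v_a))m(a)$, $A_v^{\pm}=\{a\mid\partial_\pm a=v\}$, $v_a$ the opposite endpoint. The spectrum is the multiset of eigenvalues counted with multiplicity (as roots of the characteristic polynomial). Directed paths and $u\rightsquigarrow v$: sequences $v_0,a_1,\dots,a_p,v_p$ with $\partial_-a_j=v_{j-1}$, $\partial_+a_j=v_j$, distinct vertices. A strongly connected component (SCC) is a maximal induced subdigraph with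 $u\rightsquigarrow v$ and $v\rightsquigarrow u$ for all its vertices. A source is the vertex set $F$ of an SCC with no arc from $V\setminus F$ into $F$; a sink is the vertex set $S$ of an SCC with no arc from $S$ into $V\setminus S$. *)

theory Defs
  imports
    Complex_Main
    "HOL-Computational_Algebra.Polynomial"
    "Jordan_Normal_Form.Char_Poly"
    "Graph_Theory.Digraph_Component"
begin

text \<open>
  A finite digraph is an instance of \<^locale>\<open>fin_digraph\<close>: vertices and arcs have different types,
  so the two sets are automatically disjoint; loops and multiple arcs are allowed;
  \<^const>\<open>tail\<close> is the initial vertex of an arc and \<^const>\<open>head\<close> its terminal vertex.
\<close>

locale weighted_digraph = fin_digraph G
  for G :: "('a, 'b) pre_digraph" (structure) +
  fixes mV :: "'a \<Rightarrow> real" and mA :: "'b \<Rightarrow> real"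
  assumes mV_pos: "v \<in> verts G \<Longrightarrow> 0 < mV v"
    and mA_pos: "a \<in> arcs G \<Longrightarrow> 0 < mA a"


section \<open>Sources and sinks\<close>

definition sources :: "('a, 'b) pre_digraph \<Rightarrow> 'a set set" where
  "sources G = {F. (\<exists>H \<in> pre_digraph.sccs G. F = verts H) \<and>
     \<not> (\<exists>a \<in> arcs G. tail G a \<in> verts G - F \<and> head G a \<in> F)}"

definition sinks :: "('a, 'b) pre_digraph \<Rightarrow> 'a set set" where
  "sinks G = {S. (\<exists>H \<in> pre_digraph.sccs G. S = verts H) \<and>
     \<not> (\<exists>a \<in> arcs G. tail G a \<in> S \<and> head G a \<in> verts G - S)}"

text \<open>
  The relation \<^const>\<open>reachable\<close> underlying \<^const>\<open>pre_digraph.sccs\<close> is a reflexive-transitive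
  closure; it agrees with the existence of a directed path with distinct vertices.
\<close>

lemma (in wf_digraph) reachable_iff_apath: "u \<rightarrow>\<^sup>* v \<longleftrightarrow> (\<exists>p. apath u p v)"
  unfolding reachable_awalk
  using apath_awalk_to_apath awalkI_apath by blast


section \<open>Weighted sequence spaces and adjoints\<close>

text \<open>
  A function on a finite set \<open>X\<close> is represented by its extension by zero.
\<close>

definition ell2 :: "'x set \<Rightarrow> ('x \<Rightarrow> complex) set" where
  "ell2 X = {\<phi>. \<forall>x. x \<notin> X \<longrightarrow> \<phi> x = 0}"

definition ell2_inner :: "'x set \<Rightarrow> ('x \<Rightarrow> real) \<Rightarrow> ('x \<Rightarrow> complex) \<Rightarrow> ('x \<Rightarrow> complex) \<Rightarrow> complex" where
  "ell2_inner X m \<phi> \<psi> = (\<Sum>x\<in>X. \<phi> x * cnj (\<psi> x) * complex_of_real (m x))"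

definition hilbert_adjoint ::
  "'x set \<Rightarrow> ('x \<Rightarrow> real) \<Rightarrow> 'y set \<Rightarrow> ('y \<Rightarrow> real) \<Rightarrow>
   (('x \<Rightarrow> complex) \<Rightarrow> ('y \<Rightarrow> complex)) \<Rightarrow> ('y \<Rightarrow> complex) \<Rightarrow> ('x \<Rightarrow> complex)" where
  "hilbert_adjoint X mX Y mY T \<eta> =
     (THE \<psi>. \<psi> \<in> ell2 X \<and> (\<forall>\<phi>\<in>ell2 X. ell2_inner Y mY (T \<phi>) \<eta> = ell2_inner X mX \<phi> \<psi>))"


section \<open>Derivatives and Laplacians\<close>

definition d_plus :: "('a, 'b) pre_digraph \<Rightarrow> ('a \<Rightarrow> complex) \<Rightarrow> ('b \<Rightarrow> complex)" where
  "d_plus G \<phi> = (\<lambda>a. if a \<in> arcs G then \<phi> (head G a) else 0)"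

definition d_minus :: "('a, 'b) pre_digraph \<Rightarrow> ('a \<Rightarrow> complex) \<Rightarrow> ('b \<Rightarrow> complex)" where
  "d_minus G \<phi> = (\<lambda>a. if a \<in> arcs G then - \<phi> (tail G a) else 0)"

definition d_total :: "('a, 'b) pre_digraph \<Rightarrow> ('a \<Rightarrow> complex) \<Rightarrow> ('b \<Rightarrow> complex)" where
  "d_total G \<phi> = (\<lambda>a. d_plus G \<phi> a + d_minus G \<phi> a)"

definition laplacian_plus ::
  "('a, 'b) pre_digraph \<Rightarrow> ('a \<Rightarrow> real) \<Rightarrow> ('b \<Rightarrow> real) \<Rightarrow> ('a \<Rightarrow> complex) \<Rightarrow> ('a \<Rightarrow> complex)" where
  "laplacian_plus G mV mA = hilbert_adjoint (verts G) mV (arcs G) mA (d_plus G) \<circ> d_total G"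

definition laplacian_minus ::
  "('a, 'b) pre_digraph \<Rightarrow> ('a \<Rightarrow> real) \<Rightarrow> ('b \<Rightarrow> real) \<Rightarrow> ('a \<Rightarrow> complex) \<Rightarrow> ('a \<Rightarrow> complex)" where
  "laplacian_minus G mV mA = hilbert_adjoint (verts G) mV (arcs G) mA (d_minus G) \<circ> d_total G"


subsection \<open>Existence of the adjoints and explicit formulas\<close>

lemma hilbert_adjoint_eqI:
  assumes "finite X" and pos: "\<And>x. x \<in> X \<Longrightarrow> 0 < mX x"
    and \<psi>: "\<psi> \<in> ell2 X"
    and eq: "\<And>\<phi>. \<phi> \<in> ell2 X \<Longrightarrow> ell2_inner Y mY (T \<phi>) \<eta> = ell2_inner X mX \<phi> \<psi>"
  shows "hilbert_adjoint X mX Y mY T \<eta> = \<psi>"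
  unfolding hilbert_adjoint_def
proof (rule the_equality)
  show "\<psi> \<in> ell2 X \<and> (\<forall>\<phi>\<in>ell2 X. ell2_inner Y mY (T \<phi>) \<eta> = ell2_inner X mX \<phi> \<psi>)"
    using \<psi> eq by blast
next
  fix \<psi>' assume *: "\<psi>' \<in> ell2 X \<and>
    (\<forall>\<phi>\<in>ell2 X. ell2_inner Y mY (T \<phi>) \<eta> = ell2_inner X mX \<phi> \<psi>')"
  show "\<psi>' = \<psi>"
  proof
    fix x
    show "\<psi>' x = \<psi> x"
    proof (cases "x \<in> X")
      case False
      then show ?thesis using * \<psi> by (simp add: ell2_def)
    next
      case True
      define \<delta> :: "'a \<Rightarrow> complex" where "\<delta> = (\<lambda>y. if y = x then 1 else 0)"
      have \<delta>: "\<delta> \<in> ell2 X" using True by (auto simp: ell2_def \<delta>_def)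
      have inner: "ell2_inner X mX \<delta> \<chi> = cnj (\<chi> x) * complex_of_real (mX x)" for \<chi>
      proof -
        have "ell2_inner X mX \<delta> \<chi> =
            (\<Sum>y\<in>X. if y = x then cnj (\<chi> x) * complex_of_real (mX x) else 0)"
          unfolding ell2_inner_def \<delta>_def by (rule sum.cong) auto
        then show ?thesis using \<open>finite X\<close> True by simp
      qed
      have "ell2_inner X mX \<delta> \<psi>' = ell2_inner X mX \<delta> \<psi>" using * eq \<delta> by metis
      then show ?thesis using inner pos[OF True] by simp
    qed
  qed
qed

context weighted_digraph
begin

lemma adjoint_d_plus:
  "hilbert_adjoint (verts G) mV (arcs G) mA (d_plus G) \<eta> =
     (\<lambda>v. if v \<in> verts G
          then (\<Sum>a | a \<in> arcs G \<and> head G a = v. \<eta> a * complex_of_real (mA a)) / complex_of_real (mV v)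
          else 0)" (is "_ = ?\<psi>")
proof (rule hilbert_adjoint_eqI)
  fix \<phi> :: "'a \<Rightarrow> complex"
  have "ell2_inner (verts G) mV \<phi> ?\<psi> =
      (\<Sum>v\<in>verts G. \<Sum>a | a \<in> arcs G \<and> head G a = v. \<phi> (head G a) * cnj (\<eta> a) * complex_of_real (mA a))"
    unfolding ell2_inner_def
  proof (rule sum.cong)
    fix v assume "v \<in> verts G"
    then show "\<phi> v * cnj (?\<psi> v) * complex_of_real (mV v) =
        (\<Sum>a | a \<in> arcs G \<and> head G a = v. \<phi> (head G a) * cnj (\<eta> a) * complex_of_real (mA a))"
      using mV_pos[of v] by (simp add: sum_distrib_left mult.assoc)
  qed simp
  also have "\<dots> = (\<Sum>a\<in>arcs G. \<phi> (head G a) * cnj (\<eta> a) * complex_of_real (mA a))"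
    by (rule sum.group) auto
  also have "\<dots> = ell2_inner (arcs G) mA (d_plus G \<phi>) \<eta>"
    by (simp add: ell2_inner_def d_plus_def)
  finally show "ell2_inner (arcs G) mA (d_plus G \<phi>) \<eta> = ell2_inner (verts G) mV \<phi> ?\<psi>" ..
qed (auto simp: ell2_def mV_pos)

lemma adjoint_d_minus:
  "hilbert_adjoint (verts G) mV (arcs G) mA (d_minus G) \<eta> =
     (\<lambda>v. if v \<in> verts G
          then - (\<Sum>a | a \<in> arcs G \<and> tail G a = v. \<eta> a * complex_of_real (mA a)) / complex_of_real (mV v)
          else 0)" (is "_ = ?\<psi>")
proof (rule hilbert_adjoint_eqI)
  fix \<phi> :: "'a \<Rightarrow> complex"
  have "ell2_inner (verts G) mV \<phi> ?\<psi> =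
      (\<Sum>v\<in>verts G. \<Sum>a | a \<in> arcs G \<and> tail G a = v. - (\<phi> (tail G a) * cnj (\<eta> a) * complex_of_real (mA a)))"
    unfolding ell2_inner_def
  proof (rule sum.cong)
    fix v assume "v \<in> verts G"
    then show "\<phi> v * cnj (?\<psi> v) * complex_of_real (mV v) =
        (\<Sum>a | a \<in> arcs G \<and> tail G a = v. - (\<phi> (tail G a) * cnj (\<eta> a) * complex_of_real (mA a)))"
      using mV_pos[of v] by (simp add: sum_distrib_left mult.assoc sum_negf)
  qed simp
  also have "\<dots> = (\<Sum>a\<in>arcs G. - (\<phi> (tail G a) * cnj (\<eta> a) * complex_of_real (mA a)))"
    by (rule sum.group) auto
  also have "\<dots> = ell2_inner (arcs G) mA (d_minus G \<phi>) \<eta>"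
    by (simp add: ell2_inner_def d_minus_def)
  finally show "ell2_inner (arcs G) mA (d_minus G \<phi>) \<eta> = ell2_inner (verts G) mV \<phi> ?\<psi>" ..
qed (auto simp: ell2_def mV_pos)

lemma laplacian_plus_explicit:
  assumes "v \<in> verts G"
  shows "laplacian_plus G mV mA \<phi> v =
    (\<Sum>a | a \<in> arcs G \<and> head G a = v. (\<phi> v - \<phi> (tail G a)) * complex_of_real (mA a)) / complex_of_real (mV v)"
  using assms
  by (simp add: laplacian_plus_def adjoint_d_plus d_total_def d_plus_def d_minus_def)

lemma laplacian_minus_explicit:
  assumes "v \<in> verts G"
  shows "laplacian_minus G mV mA \<phi> v =
    (\<Sum>a | a \<in> arcs G \<and> tail G a = v. (\<phi> v - \<phi> (head G a)) * complex_of_real (mA a)) / complex_of_real (mV v)"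
proof -
  have "- (\<Sum>a | a \<in> arcs G \<and> tail G a = v. d_total G \<phi> a * complex_of_real (mA a)) =
      (\<Sum>a | a \<in> arcs G \<and> tail G a = v. (\<phi> v - \<phi> (head G a)) * complex_of_real (mA a))"
    unfolding sum_negf[symmetric]
    by (rule sum.cong) (auto simp: d_total_def d_plus_def d_minus_def algebra_simps)
  then show ?thesis using assms by (simp add: laplacian_minus_def adjoint_d_minus)
qed

end


section \<open>Spectrum with multiplicities\<close>

text \<open>
  The matrix of an operator on \<open>ell2 X\<close> in the basis of point masses, listed in the order \<open>xs\<close>.
\<close>

definition op_matrix :: "'x list \<Rightarrow> (('x \<Rightarrow> complex) \<Rightarrow> ('x \<Rightarrow> complex)) \<Rightarrow> complex mat" where
  "op_matrix xs T =
     mat (length xs) (length xs) (\<lambda>(i, j). T (\<lambda>x. if x = xs ! j then 1 else 0) (xs ! i))"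

text \<open>
  The chosen enumeration of the finite set \<open>X\<close> is immaterial, see \<open>op_char_poly_eq\<close>.
\<close>

definition op_char_poly :: "'x set \<Rightarrow> (('x \<Rightarrow> complex) \<Rightarrow> ('x \<Rightarrow> complex)) \<Rightarrow> complex poly" where
  "op_char_poly X T = char_poly (op_matrix (SOME xs. distinct xs \<and> set xs = X) T)"

definition op_spectrum :: "'x set \<Rightarrow> (('x \<Rightarrow> complex) \<Rightarrow> ('x \<Rightarrow> complex)) \<Rightarrow> complex multiset" where
  "op_spectrum X T = proots (op_char_poly X T)"

definition eigenvalue_multiplicity ::
  "'x set \<Rightarrow> (('x \<Rightarrow> complex) \<Rightarrow> ('x \<Rightarrow> complex)) \<Rightarrow> complex \<Rightarrow> nat" where
  "eigenvalue_multiplicity X T z = count (op_spectrum X T) z"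

definition simple_eigenvalue ::
  "'x set \<Rightarrow> (('x \<Rightarrow> complex) \<Rightarrow> ('x \<Rightarrow> complex)) \<Rightarrow> complex \<Rightarrow> bool" where
  "simple_eigenvalue X T z \<longleftrightarrow> eigenvalue_multiplicity X T z = 1"

lemma op_matrix_similar:
  assumes xs: "distinct xs" and ys: "distinct ys" and set_eq: "set xs = set ys"
  shows "similar_mat (op_matrix xs T) (op_matrix ys T)"
proof -
  define n where "n = length xs"
  have n': "length ys = n" using assms by (metis distinct_card n_def)
  define P :: "complex mat" where "P = mat n n (\<lambda>(i, j). if xs ! i = ys ! j then 1 else 0)"
  define Q :: "complex mat" where "Q = mat n n (\<lambda>(i, j). if ys ! i = xs ! j then 1 else 0)"
  have bx: "bij_betw ((!) xs) {0..<n} (set xs)" and b_y: "bij_betw ((!) ys) {0..<n} (set xs)"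
    using bij_betw_nth[OF xs] bij_betw_nth[OF ys] n' n_def set_eq by (simp_all add: atLeast0LessThan)
  have sum_ys: "(\<Sum>j = 0..<n. f (ys ! j)) = (\<Sum>x\<in>set xs. f x)" for f :: "_ \<Rightarrow> complex"
    using sum.reindex_bij_betw[OF b_y, of f] by simp
  have sum_xs: "(\<Sum>j = 0..<n. f (xs ! j)) = (\<Sum>x\<in>set xs. f x)" for f :: "_ \<Rightarrow> complex"
    using sum.reindex_bij_betw[OF bx, of f] by simp
  have in_xs: "xs ! i \<in> set xs" "ys ! i \<in> set xs" if "i < n" for i
    using that nth_mem[of i xs] nth_mem[of i ys] n' by (simp_all only: n_def set_eq)
  have eq_xs: "xs ! i = xs ! j \<longleftrightarrow> i = j" if "i < n" "j < n" for i j
    using that xs n_def by (simp add: nth_eq_iff_index_eq)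
  have eq_ys: "ys ! i = ys ! j \<longleftrightarrow> i = j" if "i < n" "j < n" for i j
    using that ys n' by (simp add: nth_eq_iff_index_eq)
  have PQ: "P * Q = 1\<^sub>m n"
  proof (rule eq_matI)
    fix i j assume "i < dim_row (1\<^sub>m n)" "j < dim_col (1\<^sub>m n)"
    then have ij: "i < n" "j < n" by auto
    have "(P * Q) $$ (i, j) =
        (\<Sum>k = 0..<n. (if xs ! i = ys ! k then 1 else 0) * (if ys ! k = xs ! j then 1 else 0))"
      using ij by (simp add: P_def Q_def scalar_prod_def)
    also have "\<dots> = (\<Sum>x\<in>set xs. (if xs ! i = x then 1 else 0) * (if x = xs ! j then 1 else 0))"
      by (rule sum_ys)
    also have "\<dots> = (\<Sum>x\<in>set xs. if x = xs ! i then (if xs ! i = xs ! j then 1 else 0) else 0)"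
      by (rule sum.cong) auto
    also have "\<dots> = (if xs ! i = xs ! j then 1 else 0)"
      using in_xs(1)[OF ij(1)] by simp
    finally show "(P * Q) $$ (i, j) = 1\<^sub>m n $$ (i, j)"
      using ij eq_xs[OF ij] by simp
  qed (auto simp: P_def Q_def)
  have QP: "Q * P = 1\<^sub>m n"
    by (rule mat_mult_left_right_inverse[OF _ _ PQ]) (auto simp: P_def Q_def)
  define A B where "A = op_matrix xs T" and "B = op_matrix ys T"
  have car: "A \<in> carrier_mat n n" "B \<in> carrier_mat n n" "P \<in> carrier_mat n n" "Q \<in> carrier_mat n n"
    by (auto simp: A_def B_def op_matrix_def P_def Q_def n' n_def)
  have AP: "A * P = P * B"
  proof (rule eq_matI)
    fix i j assume "i < dim_row (P * B)" "j < dim_col (P * B)"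
    then have ij: "i < n" "j < n" using car by auto
    define e :: "'a \<Rightarrow> 'a \<Rightarrow> complex" where "e = (\<lambda>z x. if x = z then 1 else 0)"
    have "(A * P) $$ (i, j) = (\<Sum>k = 0..<n. T (e (xs ! k)) (xs ! i) * (if xs ! k = ys ! j then 1 else 0))"
      using ij by (simp add: A_def P_def op_matrix_def scalar_prod_def n_def e_def)
    also have "\<dots> = (\<Sum>x\<in>set xs. T (e x) (xs ! i) * (if x = ys ! j then 1 else 0))"
      by (rule sum_xs)
    also have "\<dots> = (\<Sum>x\<in>set xs. if x = ys ! j then T (e (ys ! j)) (xs ! i) else 0)"
      by (rule sum.cong) auto
    also have "\<dots> = T (e (ys ! j)) (xs ! i)"
      using in_xs(2)[OF ij(2)] by simp
    finally have 1: "(A * P) $$ (i, j) = T (e (ys ! j)) (xs ! i)" .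
    have "(P * B) $$ (i, j) = (\<Sum>k = 0..<n. (if xs ! i = ys ! k then 1 else 0) * T (e (ys ! j)) (ys ! k))"
      using ij by (simp add: B_def P_def op_matrix_def scalar_prod_def n' e_def)
    also have "\<dots> = (\<Sum>x\<in>set xs. (if xs ! i = x then 1 else 0) * T (e (ys ! j)) x)"
      by (rule sum_ys)
    also have "\<dots> = (\<Sum>x\<in>set xs. if x = xs ! i then T (e (ys ! j)) (xs ! i) else 0)"
      by (rule sum.cong) auto
    also have "\<dots> = T (e (ys ! j)) (xs ! i)"
      using in_xs(1)[OF ij(1)] by simp
    finally show "(A * P) $$ (i, j) = (P * B) $$ (i, j)" using 1 by simp
  qed (use car in auto)
  have "A = A * (P * Q)" using car PQ by simp
  also have "\<dots> = A * P * Q" by (rule assoc_mult_mat[OF car(1,3,4), symmetric])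
  also have "\<dots> = P * B * Q" unfolding AP ..
  finally have "similar_mat_wit A B P Q"
    unfolding similar_mat_wit_def Let_def using car PQ QP by auto
  then show ?thesis unfolding similar_mat_def A_def B_def by blast
qed

lemma op_char_poly_eq:
  assumes "distinct xs" and "set xs = X"
  shows "op_char_poly X T = char_poly (op_matrix xs T)"
proof -
  have "distinct (SOME xs. distinct xs \<and> set xs = X) \<and> set (SOME xs. distinct xs \<and> set xs = X) = X"
    by (rule someI[of _ xs]) (use assms in simp)
  then show ?thesis
    unfolding op_char_poly_def
    by (intro char_poly_similar op_matrix_similar) (use assms in auto)
qed

end

theory Submission
  imports Defs "Jordan_Normal_Form.Schur_Decomposition"
begin

text \<open>
  The functions vanishing on all sources, and the functions that in addition may take a nonzero
  constant value on each source, form a flag of subspaces that is invariant under the in-Laplacian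
  \<open>L\<close>: the value of \<open>L \<phi>\<close> at a vertex of a source depends only on \<open>\<phi>\<close> on that source. On the first
  subspace \<open>L\<close> is injective by the maximum principle, since every vertex is reachable from a
  source; the second subspace is mapped into the first; and on the remaining quotient
  \<open>L\<close> is injective, because a function with constant Laplacian on a strongly connected closed
  class is itself constant there. Hence \<open>0\<close> is a root of the characteristic polynomial exactly as
  often as the middle quotient has dimensions, that is, once for each source.
\<close>

section \<open>Characteristic polynomials of operators\<close>

definition point_mass :: "'x \<Rightarrow> 'x \<Rightarrow> complex" where
  "point_mass z = (\<lambda>x. if x = z then 1 else 0)"

definition op_linear :: "(('x \<Rightarrow> complex) \<Rightarrow> ('y \<Rightarrow> complex)) \<Rightarrow> bool" where
  "op_linear T \<longleftrightarrow> (\<forall>\<phi> \<psi>. T (\<lambda>x. \<phi> x + \<psi> x) = (\<lambda>y. T \<phi> y + T \<psi> y)) \<and>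
     (\<forall>k \<phi>. T (\<lambda>x. k * \<phi> x) = (\<lambda>y. k * T \<phi> y))"

lemma op_linearD:
  assumes "op_linear T"
  shows "T (\<lambda>x. \<phi> x + \<psi> x) y = T \<phi> y + T \<psi> y" and "T (\<lambda>x. k * \<phi> x) y = k * T \<phi> y"
  using assms by (auto simp: op_linear_def)

lemma op_linear_comp: "op_linear T \<Longrightarrow> op_linear S \<Longrightarrow> op_linear (T \<circ> S)"
  by (simp add: op_linear_def)

lemma point_mass_in_ell2: "x \<in> X \<Longrightarrow> point_mass x \<in> ell2 X"
  by (auto simp: ell2_def point_mass_def)

lemma op_linear_sum:
  assumes "op_linear T" "finite I"
  shows "T (\<lambda>x. \<Sum>i\<in>I. k i * h i x) y = (\<Sum>i\<in>I. k i * T (h i) y)"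
  using assms(2)
proof (induction I rule: finite_induct)
  case empty
  show ?case using op_linearD(2)[OF assms(1), of 0 "\<lambda>_. 0" y] by simp
next
  case (insert i I)
  then show ?case using op_linearD[OF assms(1)] by simp
qed

lemma op_linear_expand:
  assumes "op_linear T" "finite X" "\<phi> \<in> ell2 X"
  shows "T \<phi> y = (\<Sum>z\<in>X. \<phi> z * T (point_mass z) y)"
proof -
  have "\<phi> = (\<lambda>x. \<Sum>z\<in>X. \<phi> z * point_mass z x)"
  proof
    fix x
    have "(\<Sum>z\<in>X. \<phi> z * point_mass z x) = (\<Sum>z\<in>X. if z = x then \<phi> x else 0)"
      by (rule sum.cong) (auto simp: point_mass_def)
    then show "\<phi> x = (\<Sum>z\<in>X. \<phi> z * point_mass z x)"
      using assms by (auto simp: ell2_def)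
  qed
  then show ?thesis using op_linear_sum[OF assms(1,2), of \<phi> point_mass y] by simp
qed

lemma op_matrix_index:
  "i < length xs \<Longrightarrow> j < length xs \<Longrightarrow> op_matrix xs T $$ (i, j) = T (point_mass (xs ! j)) (xs ! i)"
  by (simp add: op_matrix_def point_mass_def)

lemma op_matrix_carrier: "op_matrix xs T \<in> carrier_mat (length xs) (length xs)"
  by (simp add: op_matrix_def)

lemma op_matrix_dim [simp]: "dim_row (op_matrix xs T) = length xs" "dim_col (op_matrix xs T) = length xs"
  by (simp_all add: op_matrix_def)

lemma sum_nth_distinct:
  assumes "distinct xs"
  shows "(\<Sum>i = 0..<length xs. h (xs ! i)) = (\<Sum>x\<in>set xs. h x)"
  using sum.reindex_bij_betw[OF bij_betw_nth[OF assms refl refl], of h]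
  by (simp add: atLeast0LessThan)

lemma op_char_poly_cong:
  assumes "\<And>\<phi> x. x \<in> X \<Longrightarrow> T \<phi> x = T' \<phi> x" "finite X"
  shows "op_char_poly X T = op_char_poly X T'"
proof -
  obtain xs where xs: "distinct xs" "set xs = X"
    using finite_distinct_list[OF assms(2)] by blast
  have "op_matrix xs T = op_matrix xs T'"
    by (rule eq_matI) (use assms(1) xs in \<open>auto simp: op_matrix_index\<close>)
  then show ?thesis by (simp add: op_char_poly_eq[OF xs])
qed

lemma op_matrix_comp:
  assumes "op_linear T" "distinct xs" "\<And>\<phi>. \<phi> \<in> ell2 (set xs) \<Longrightarrow> S \<phi> \<in> ell2 (set xs)"
  shows "op_matrix xs (T \<circ> S) = op_matrix xs T * op_matrix xs S"
proof (rule eq_matI)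
  fix i j assume "i < dim_row (op_matrix xs T * op_matrix xs S)"
    and "j < dim_col (op_matrix xs T * op_matrix xs S)"
  then have ij: "i < length xs" "j < length xs" by auto
  have "(op_matrix xs T * op_matrix xs S) $$ (i, j) =
      (\<Sum>k = 0..<length xs. T (point_mass (xs ! k)) (xs ! i) * S (point_mass (xs ! j)) (xs ! k))"
    using ij by (simp add: op_matrix_index scalar_prod_def)
  also have "\<dots> = (\<Sum>z\<in>set xs. T (point_mass z) (xs ! i) * S (point_mass (xs ! j)) z)"
    by (rule sum_nth_distinct[OF assms(2)])
  also have "\<dots> = T (S (point_mass (xs ! j))) (xs ! i)"
    using op_linear_expand[OF assms(1) finite_set assms(3)[OF point_mass_in_ell2[OF nth_mem[OF ij(2)]]]]
    by (simp add: mult.commute)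
  finally show "op_matrix xs (T \<circ> S) $$ (i, j) = (op_matrix xs T * op_matrix xs S) $$ (i, j)"
    using ij by (simp add: op_matrix_index)
qed auto

text \<open>\<open>R\<close> is a left inverse of \<open>S\<close> on a space of finite dimension,
  so their matrices are two-sided inverses and the conjugated matrix is similar to that of
  \<open>T\<close>.\<close>

lemma op_char_poly_conjugate:
  assumes "finite X" "op_linear R" "op_linear T"
    and S: "\<And>\<phi>. \<phi> \<in> ell2 X \<Longrightarrow> S \<phi> \<in> ell2 X"
    and T: "\<And>\<phi>. \<phi> \<in> ell2 X \<Longrightarrow> T \<phi> \<in> ell2 X"
    and RS: "\<And>\<phi>. \<phi> \<in> ell2 X \<Longrightarrow> R (S \<phi>) = \<phi>"
  shows "op_char_poly X (R \<circ> (T \<circ> S)) = op_char_poly X T"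
proof -
  obtain xs where xs: "distinct xs" "set xs = X"
    using finite_distinct_list[OF assms(1)] by blast
  define n where "n = length xs"
  let ?M = "op_matrix xs"
  have car: "?M U \<in> carrier_mat n n" for U :: "('a \<Rightarrow> complex) \<Rightarrow> 'a \<Rightarrow> complex"
    by (simp add: n_def op_matrix_carrier)
  have one: "?M R * ?M S = 1\<^sub>m n"
  proof -
    have "?M (R \<circ> S) = 1\<^sub>m n"
    proof (rule eq_matI)
      fix i j assume "i < dim_row (1\<^sub>m n)" "j < dim_col (1\<^sub>m n)"
      then show "?M (R \<circ> S) $$ (i, j) = 1\<^sub>m n $$ (i, j)"
        using xs by (auto simp: n_def op_matrix_index RS point_mass_in_ell2 nth_eq_iff_index_eq)
          (auto simp: point_mass_def nth_eq_iff_index_eq)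
    qed (auto simp: n_def)
    then show ?thesis using op_matrix_comp[OF assms(2) xs(1)] S xs(2) by simp
  qed
  have one': "?M S * ?M R = 1\<^sub>m n"
    by (rule mat_mult_left_right_inverse[OF car car one])
  have "?M (R \<circ> (T \<circ> S)) = ?M R * (?M T * ?M S)"
    using op_matrix_comp[OF assms(2) xs(1), of "T \<circ> S"] op_matrix_comp[OF assms(3) xs(1), of S] S T xs(2)
    by simp
  also have "\<dots> = ?M R * ?M T * ?M S"
    by (rule assoc_mult_mat[OF car car car, symmetric])
  finally have "similar_mat_wit (?M (R \<circ> (T \<circ> S))) (?M T) (?M R) (?M S)"
    unfolding similar_mat_wit_def Let_def using car one one' by (auto simp: n_def)
  then have "char_poly (?M (R \<circ> (T \<circ> S))) = char_poly (?M T)"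
    by (intro char_poly_similar) (auto simp: similar_mat_def)
  then show ?thesis by (simp add: op_char_poly_eq[OF xs])
qed

text \<open>Listing \<open>X\<close> before \<open>Y\<close> places the hypothesis in the lower left
  block, so the matrix is block triangular. Each factor belongs to a compression of
  \<open>T\<close>: values outside the listed set are dropped.\<close>

lemma op_char_poly_union:
  assumes "finite X" "finite Y" "X \<inter> Y = {}"
    and zero: "\<And>x y. x \<in> X \<Longrightarrow> y \<in> Y \<Longrightarrow> T (point_mass x) y = 0"
  shows "op_char_poly (X \<union> Y) T = op_char_poly X T * op_char_poly Y T"
proof -
  obtain xs where xs: "distinct xs" "set xs = X"
    using finite_distinct_list[OF assms(1)] by blast
  obtain ys where ys: "distinct ys" "set ys = Y"
    using finite_distinct_list[OF assms(2)] by blast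
  define n m where "n = length xs" and "m = length ys"
  define C where "C = mat n m (\<lambda>(i, j). T (point_mass (ys ! j)) (xs ! i))"
  have "op_matrix (xs @ ys) T = four_block_mat (op_matrix xs T) C (0\<^sub>m m n) (op_matrix ys T)"
    by (rule eq_matI)
      (use xs ys zero in \<open>auto simp: op_matrix_index n_def m_def C_def nth_append\<close>)
  \<comment> \<open>Over the complex numbers both diagonal blocks have characteristic polynomials
    that split into linear factors, as \<open>char_poly_0_block\<close> demands.\<close>
  then have "char_poly (op_matrix (xs @ ys) T) = char_poly (op_matrix xs T) * char_poly (op_matrix ys T)"
    by (rule char_poly_0_block)
      (use char_poly_factorized[OF op_matrix_carrier] in \<open>auto simp: n_def m_def C_def op_matrix_carrier\<close>)
  moreover have "distinct (xs @ ys)" "set (xs @ ys) = X \<union> Y" using xs ys assms(3) by auto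
  ultimately show ?thesis
    using op_char_poly_eq[of "xs @ ys"] op_char_poly_eq[OF xs] op_char_poly_eq[OF ys] by metis
qed

lemma op_char_poly_zero:
  assumes "finite X" "\<And>x y. x \<in> X \<Longrightarrow> y \<in> X \<Longrightarrow> T (point_mass x) y = 0"
  shows "op_char_poly X T = [:0, 1:] ^ card X"
proof -
  obtain xs where xs: "distinct xs" "set xs = X"
    using finite_distinct_list[OF assms(1)] by blast
  have M: "op_matrix xs T = 0\<^sub>m (card X) (card X)"
    by (rule eq_matI) (use xs assms(2) distinct_card[OF xs(1)] in \<open>auto simp: op_matrix_index\<close>)
  have "char_poly (op_matrix xs T) = [:0, 1:] ^ card X"
  proof -
    have "map (\<lambda>a. [:- a, 1:]) (diag_mat (0\<^sub>m (card X) (card X))) =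
        replicate (card X) [:0, 1 :: complex:]"
      by (rule nth_equalityI) (auto simp: diag_mat_def)
    then show ?thesis
      unfolding M by (subst char_poly_upper_triangular[of _ "card X"]) auto
  qed
  then show ?thesis by (simp add: op_char_poly_eq[OF xs])
qed

text \<open>A root 0 yields a kernel vector of the matrix, which becomes a function in
  \<open>ell2 X\<close> through the enumeration of \<open>X\<close>. The premise tests
  \<open>T \<phi>\<close> on \<open>X\<close> alone, because the matrix describes the compression of
  \<open>T\<close> to \<open>X\<close>.\<close>

lemma op_char_poly_0_nonzero:
  assumes "finite X" "op_linear T"
    and inj: "\<And>\<phi> x. \<phi> \<in> ell2 X \<Longrightarrow> (\<And>x. x \<in> X \<Longrightarrow> T \<phi> x = 0) \<Longrightarrow> x \<in> X \<Longrightarrow> \<phi> x = 0"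
  shows "poly (op_char_poly X T) 0 \<noteq> 0"
proof
  obtain xs where xs: "distinct xs" "set xs = X"
    using finite_distinct_list[OF assms(1)] by blast
  define n where "n = length xs"
  assume "poly (op_char_poly X T) 0 = 0"
  then have "eigenvalue (op_matrix xs T) 0"
    by (simp add: op_char_poly_eq[OF xs] eigenvalue_root_char_poly[OF op_matrix_carrier])
  then obtain w where w: "w \<in> carrier_vec n" "w \<noteq> 0\<^sub>v n" "op_matrix xs T *\<^sub>v w = 0 \<cdot>\<^sub>v w"
    by (auto simp: eigenvalue_def eigenvector_def n_def)
  define \<phi> where "\<phi> x = (if x \<in> X then w $ (inv_into {..<n} ((!) xs) x) else 0)" for x
  have bij: "bij_betw ((!) xs) {..<n} X"
    using bij_betw_nth[OF xs(1) refl refl] xs(2) by (simp add: n_def)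
  have \<phi>_nth: "\<phi> (xs ! i) = w $ i" if "i < n" for i
    using that bij xs by (auto simp: \<phi>_def n_def bij_betw_def inv_into_f_f)
  have \<phi>: "\<phi> \<in> ell2 X" by (auto simp: ell2_def \<phi>_def)
  have "T \<phi> x = 0" if x: "x \<in> X" for x
  proof -
    obtain i where i: "i < n" "x = xs ! i"
      using x xs(2) by (metis in_set_conv_nth n_def)
    have "T \<phi> x = (\<Sum>z\<in>set xs. \<phi> z * T (point_mass z) x)"
      using op_linear_expand[OF assms(2,1) \<phi>] xs(2) by simp
    also have "\<dots> = (\<Sum>k = 0..<n. \<phi> (xs ! k) * T (point_mass (xs ! k)) x)"
      unfolding n_def by (rule sum_nth_distinct[OF xs(1), symmetric])
    also have "\<dots> = (op_matrix xs T *\<^sub>v w) $ i"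
      using i w(1) by (simp add: scalar_prod_def op_matrix_index \<phi>_nth n_def mult.commute)
    also have "\<dots> = 0" using w i by simp
    finally show ?thesis .
  qed
  then have "\<phi> x = 0" if "x \<in> X" for x using inj \<phi> that by blast
  then have "w $ i = 0" if "i < n" for i
    using that \<phi>_nth xs(2) by (metis n_def nth_mem)
  then have "w = 0\<^sub>v n" using w(1) by (intro eq_vecI) auto
  then show False using w(2) by simp
qed

section \<open>Laplacians of weighted arc systems\<close>

lemma finite_ex_max:
  fixes h :: "'x \<Rightarrow> real"
  assumes "finite U" "U \<noteq> {}"
  shows "\<exists>w\<in>U. \<forall>u\<in>U. h u \<le> h w"
proof -
  have "Max (h ` U) \<in> h ` U" using assms by (intro Max_in) auto
  then show ?thesis using Max_ge[of "h ` U"] assms(1) by fastforce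
qed

text \<open>
  Reversing all arcs exchanges the in- and the out-Laplacian, so both are instances of
  \<open>lap\<close> below.
\<close>

locale weighted_arcs =
  fixes V :: "'a set" and A :: "'b set" and src tgt :: "'b \<Rightarrow> 'a" and c :: "'b \<Rightarrow> real"
  assumes finite_V: "finite V" and finite_A: "finite A"
    and src_in: "a \<in> A \<Longrightarrow> src a \<in> V" and tgt_in: "a \<in> A \<Longrightarrow> tgt a \<in> V"
    and c_pos: "a \<in> A \<Longrightarrow> 0 < c a"
begin

section \<open>Ancestors and recurrent classes\<close>

definition edges :: "('a \<times> 'a) set" where
  "edges = (\<lambda>a. (src a, tgt a)) ` A"

definition anc :: "'a \<Rightarrow> 'a set" where
  "anc v = {u. (u, v) \<in> edges\<^sup>*}"

text \<open>Markov chain terminology, for steps taken backwards along arcs: for such a vertex,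
  \<open>anc v\<close> is a strongly connected class that no arc enters.\<close>

definition recurrent :: "'a set" where
  "recurrent = {v \<in> V. \<forall>u\<in>anc v. v \<in> anc u}"

text \<open>The values lie in any real vector space, so that the maximum principle for real
  functions can be applied to the real and imaginary parts of a complex one.\<close>

definition lap :: "('a \<Rightarrow> 'x::real_vector) \<Rightarrow> 'a \<Rightarrow> 'x" where
  "lap \<phi> v = (\<Sum>a | a \<in> A \<and> tgt a = v. c a *\<^sub>R (\<phi> v - \<phi> (src a)))"

lemma anc_refl: "v \<in> anc v"
  by (simp add: anc_def)

lemma anc_trans: "u \<in> anc v \<Longrightarrow> v \<in> anc w \<Longrightarrow> u \<in> anc w"
  by (auto simp: anc_def)

lemma src_in_anc: "a \<in> A \<Longrightarrow> tgt a \<in> anc v \<Longrightarrow> src a \<in> anc v"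
  by (auto simp: anc_def edges_def intro: converse_rtrancl_into_rtrancl)

text \<open>Backward induction along a path, used to pass from single arcs to all ancestors.\<close>

lemma anc_closed:
  assumes "u \<in> anc v" "v \<in> U" "\<And>a. a \<in> A \<Longrightarrow> tgt a \<in> U \<Longrightarrow> src a \<in> U"
  shows "u \<in> U"
  using assms(1) unfolding anc_def mem_Collect_eq
  by (induction rule: converse_rtrancl_induct) (use assms(2,3) in \<open>auto simp: edges_def\<close>)

lemma anc_subset: "v \<in> V \<Longrightarrow> anc v \<subseteq> V"
  using anc_closed src_in by blast

lemma finite_anc: "v \<in> V \<Longrightarrow> finite (anc v)"
  using anc_subset finite_V finite_subset by blast

lemma recurrentD: "v \<in> recurrent \<Longrightarrow> u \<in> anc v \<Longrightarrow> v \<in> anc u"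
  by (simp add: recurrent_def)

lemma recurrent_subset: "recurrent \<subseteq> V"
  by (auto simp: recurrent_def)

lemma anc_eq:
  assumes "v \<in> recurrent" "u \<in> anc v"
  shows "anc u = anc v"
  using assms recurrentD anc_trans by blast

lemma anc_recurrent:
  assumes "v \<in> recurrent" "u \<in> anc v"
  shows "u \<in> recurrent"
  using assms anc_subset[of v] anc_eq[OF assms] recurrentD anc_trans
  unfolding recurrent_def by blast

lemma src_recurrent: "a \<in> A \<Longrightarrow> tgt a \<in> recurrent \<Longrightarrow> src a \<in> recurrent"
  using anc_recurrent src_in_anc anc_refl by blast

text \<open>Take an ancestor \<open>u\<close> with the fewest ancestors. Any ancestor
  \<open>w\<close> of \<open>u\<close> satisfies \<open>anc w \<subseteq> anc u\<close>, and
  minimality forces equality, so \<open>u\<close> reaches \<open>w\<close> back.\<close>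

lemma recurrent_ancestor:
  assumes "v \<in> V"
  obtains u where "u \<in> anc v" "u \<in> recurrent"
proof -
  obtain u where u: "u \<in> anc v" "\<And>w. w \<in> anc v \<Longrightarrow> card (anc u) \<le> card (anc w)"
    using ex_has_least_nat[of "\<lambda>u. u \<in> anc v" v "\<lambda>u. card (anc u)"] anc_refl by blast
  have uV: "u \<in> V" using u(1) anc_subset[OF assms] by blast
  have "u \<in> anc w" if w: "w \<in> anc u" for w
  proof -
    have sub: "anc w \<subseteq> anc u" using w anc_trans by blast
    have "card (anc u) \<le> card (anc w)" using u w anc_trans by blast
    then have "anc w = anc u" using card_seteq[OF finite_anc[OF uV] sub] by blast
    then show ?thesis using anc_refl by blast
  qed
  then show thesis using that u(1) uV unfolding recurrent_def by blast
qed

section \<open>The maximum principle\<close>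

lemma lap_nonneg_at_max:
  fixes \<phi> :: "'a \<Rightarrow> real"
  assumes "v \<in> U" "\<And>a. a \<in> A \<Longrightarrow> tgt a \<in> U \<Longrightarrow> src a \<in> U" "\<And>u. u \<in> U \<Longrightarrow> \<phi> u \<le> \<phi> v"
  shows "0 \<le> lap \<phi> v"
  unfolding lap_def using assms less_imp_le[OF c_pos]
  by (intro sum_nonneg scaleR_nonneg_nonneg) auto

text \<open>The set of maximum points in \<open>U\<close> is closed under predecessors: at such a
  point \<open>lap \<phi>\<close> is a nonpositive sum of nonnegative terms, so every term vanishes,
  and positive arc weights give equality at each predecessor.\<close>

lemma subharmonic_eq_max:
  fixes \<phi> :: "'a \<Rightarrow> real"
  assumes "v \<in> U" and closed: "\<And>a. a \<in> A \<Longrightarrow> tgt a \<in> U \<Longrightarrow> src a \<in> U"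
    and max: "\<And>u. u \<in> U \<Longrightarrow> \<phi> u \<le> \<phi> v"
    and sub: "\<And>u. u \<in> U \<Longrightarrow> lap \<phi> u \<le> 0"
    and "u \<in> anc v"
  shows "\<phi> u = \<phi> v"
proof -
  have "u \<in> {u \<in> U. \<phi> u = \<phi> v}"
  proof (rule anc_closed[OF assms(5)])
    fix a assume a: "a \<in> A" "tgt a \<in> {u \<in> U. \<phi> u = \<phi> v}"
    let ?I = "{b \<in> A. tgt b = tgt a}"
    have nonneg: "0 \<le> c b *\<^sub>R (\<phi> (tgt a) - \<phi> (src b))" if "b \<in> ?I" for b
      using that a less_imp_le[OF c_pos] closed max by (intro scaleR_nonneg_nonneg) auto
    have "lap \<phi> (tgt a) \<le> 0" using a sub by blast
    then have "(\<Sum>b\<in>?I. c b *\<^sub>R (\<phi> (tgt a) - \<phi> (src b))) = 0"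
      using sum_nonneg[of ?I "\<lambda>b. c b *\<^sub>R (\<phi> (tgt a) - \<phi> (src b))", OF nonneg]
      by (simp add: lap_def)
    then have "c a *\<^sub>R (\<phi> (tgt a) - \<phi> (src a)) = 0"
      using sum_nonneg_eq_0_iff[of ?I "\<lambda>b. c b *\<^sub>R (\<phi> (tgt a) - \<phi> (src b))"] nonneg finite_A a by auto
    then show "src a \<in> {u \<in> U. \<phi> u = \<phi> v}"
      using a c_pos[of a] closed by auto
  qed (use assms(1) in auto)
  then show ?thesis by simp
qed

lemma lap_uminus: "lap (\<lambda>v. - \<phi> v) v = - lap \<phi> v"
  unfolding lap_def sum_negf[symmetric] by (rule sum.cong) (auto simp: algebra_simps)

lemma lap_Re: "lap (\<lambda>v. Re (\<phi> v)) v = Re (lap \<phi> v)"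
  and lap_Im: "lap (\<lambda>v. Im (\<phi> v)) v = Im (lap \<phi> v)"
  by (simp_all add: lap_def Re_sum Im_sum)

text \<open>A global maximum is passed on to a recurrent ancestor, where the function is 0.\<close>

lemma harmonic_nonpos:
  fixes \<phi> :: "'a \<Rightarrow> real"
  assumes "\<And>v. v \<in> recurrent \<Longrightarrow> \<phi> v = 0" "\<And>v. v \<in> V \<Longrightarrow> lap \<phi> v = 0" "v \<in> V"
  shows "\<phi> v \<le> 0"
proof -
  obtain w where w: "w \<in> V" "\<And>u. u \<in> V \<Longrightarrow> \<phi> u \<le> \<phi> w"
    using finite_ex_max[OF finite_V, of \<phi>] assms(3) by blast
  obtain u where u: "u \<in> anc w" "u \<in> recurrent" using recurrent_ancestor[OF w(1)] .
  have "\<phi> u = \<phi> w"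
    by (rule subharmonic_eq_max[where U = V]) (use w u src_in assms in auto)
  then show ?thesis using assms(1)[OF u(2)] w(2)[OF assms(3)] by simp
qed

text \<open>Predecessors of recurrent vertices are recurrent, so \<open>lap \<phi>\<close> vanishes
  on \<open>recurrent\<close> as well; then \<open>harmonic_nonpos\<close> applies to the real and
  imaginary parts with both signs. This gives injectivity on the block of nonrecurrent
  vertices.\<close>

lemma harmonic_eq_0:
  fixes \<phi> :: "'a \<Rightarrow> complex"
  assumes "\<And>v. v \<in> recurrent \<Longrightarrow> \<phi> v = 0" "\<And>v. v \<in> V - recurrent \<Longrightarrow> lap \<phi> v = 0" "v \<in> V"
  shows "\<phi> v = 0"
proof -
  have "lap \<phi> u = 0" if "u \<in> recurrent" for u
    unfolding lap_def using that assms(1) src_recurrent by (auto intro!: sum.neutral)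
  then have lap0: "lap \<phi> u = 0" if "u \<in> V" for u using that assms(2) by blast
  have real: "h v = 0" if "\<And>v. v \<in> recurrent \<Longrightarrow> h v = 0" "\<And>v. v \<in> V \<Longrightarrow> lap h v = 0" for h :: "'a \<Rightarrow> real"
    using harmonic_nonpos[of h v] harmonic_nonpos[of "\<lambda>v. - h v" v] that assms(3)
    by (simp add: lap_uminus)
  show ?thesis
    using real[of "\<lambda>v. Re (\<phi> v)"] real[of "\<lambda>v. Im (\<phi> v)"] assms(1) lap0
    by (simp add: lap_Re lap_Im complex_eq_iff)
qed

text \<open>A constant value of the Laplacian on a closed class is both nonnegative and nonpositive,
  by the maximum principle at a maximum and at a minimum.\<close>

lemma const_if_lap_const_real:
  fixes \<phi> :: "'a \<Rightarrow> real"
  assumes r: "r \<in> recurrent" and const: "\<And>u. u \<in> anc r \<Longrightarrow> lap \<phi> u = lap \<phi> r"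
    and "u \<in> anc r"
  shows "\<phi> u = \<phi> r"
proof -
  have fin: "finite (anc r)" using r recurrent_subset finite_anc by blast
  have ex_max: "\<exists>w\<in>anc r. \<forall>u\<in>anc r. h u \<le> h w" for h :: "'a \<Rightarrow> real"
    using finite_ex_max[OF fin] anc_refl by blast
  obtain v where v: "v \<in> anc r" "\<And>u. u \<in> anc r \<Longrightarrow> \<phi> u \<le> \<phi> v" using ex_max[of \<phi>] by blast
  obtain w where w: "w \<in> anc r" "\<And>u. u \<in> anc r \<Longrightarrow> - \<phi> u \<le> - \<phi> w"
    using ex_max[of "\<lambda>v. - \<phi> v"] by blast
  \<comment> \<open>Since \<open>- \<phi>\<close> is maximal at \<open>w\<close>,
    \<open>lap \<phi>\<close> is nonpositive there and, being constant, on the whole class. So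
    \<open>\<phi>\<close> is subharmonic and its maximum spreads from \<open>v\<close> to all of
    \<open>anc r\<close>.\<close>
  have "0 \<le> lap (\<lambda>v. - \<phi> v) w"
    by (rule lap_nonneg_at_max[where U = "anc r"]) (use w src_in_anc in auto)
  then have le: "lap \<phi> u \<le> 0" if "u \<in> anc r" for u
    using const[OF w(1)] const[OF that] by (simp add: lap_uminus)
  have eq: "\<phi> u = \<phi> v" if "u \<in> anc r" for u
    by (rule subharmonic_eq_max[where U = "anc r"])
      (use v le that src_in_anc anc_eq[OF r v(1)] in auto)
  show ?thesis using eq[OF assms(3)] eq[OF anc_refl] by simp
qed

lemma const_if_lap_const:
  fixes \<phi> :: "'a \<Rightarrow> complex"
  assumes "r \<in> recurrent" "\<And>u. u \<in> anc r \<Longrightarrow> lap \<phi> u = lap \<phi> r" "u \<in> anc r"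
  shows "\<phi> u = \<phi> r"
  using const_if_lap_const_real[of r "\<lambda>v. Re (\<phi> v)" u] const_if_lap_const_real[of r "\<lambda>v. Im (\<phi> v)" u] assms
  by (simp add: lap_Re lap_Im complex_eq_iff)

section \<open>Change of basis adapted to the recurrent classes\<close>

lemma op_linear_lap: "op_linear (lap :: ('a \<Rightarrow> complex) \<Rightarrow> _)"
  unfolding op_linear_def lap_def
  by (auto simp: fun_eq_iff sum.distrib[symmetric] sum_distrib_left algebra_simps intro!: sum.cong)

lemma lap_in_ell2: "lap \<phi> \<in> ell2 V"
  unfolding ell2_def lap_def using tgt_in by (auto intro!: sum.neutral)

text \<open>The choice depends on \<open>v\<close> only through the set \<open>anc v\<close>, so all
  vertices of a recurrent class share one representative.\<close>

definition rep :: "'a \<Rightarrow> 'a" where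
  "rep v = (SOME u. u \<in> anc v)"

definition nonreps :: "'a set" where
  "nonreps = recurrent - rep ` recurrent"

lemma rep_in_anc: "rep v \<in> anc v"
  unfolding rep_def using anc_refl by (rule someI)

lemma rep_recurrent: "v \<in> recurrent \<Longrightarrow> rep v \<in> recurrent"
  using anc_recurrent rep_in_anc by blast

lemma rep_eq: "v \<in> recurrent \<Longrightarrow> u \<in> anc v \<Longrightarrow> rep u = rep v"
  using anc_eq by (simp add: rep_def)

lemma rep_notin_nonreps: "v \<in> recurrent \<Longrightarrow> rep v \<notin> nonreps"
  by (auto simp: nonreps_def)

lemma rep_fixed: "v \<in> recurrent \<Longrightarrow> v \<notin> nonreps \<Longrightarrow> rep v = v"
  unfolding nonreps_def using rep_eq rep_in_anc by blast

text \<open>On recurrent classes the choice of a representative is inverted by \<open>anc\<close>,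
  as a representative has the same ancestors as its class.\<close>

lemma card_rep: "card (rep ` recurrent) = card (anc ` recurrent)"
proof -
  have "inj_on (\<lambda>S. SOME u. u \<in> S) (anc ` recurrent)"
    by (rule inj_on_inverseI[where g = anc])
      (auto simp: rep_def[symmetric] anc_eq[OF _ rep_in_anc])
  moreover have "rep ` recurrent = (\<lambda>S. SOME u. u \<in> S) ` anc ` recurrent"
    by (auto simp: rep_def image_image)
  ultimately show ?thesis by (simp add: card_image)
qed

text \<open>
  \<open>spread\<close> sends the point mass at the representative of a recurrent class to the indicator
  function of the class and fixes all other point masses. In the new basis the Laplacian is
  block triangular with respect to nonrecurrent vertices, representatives and \<open>nonreps\<close>.
\<close>

definition spread :: "('a \<Rightarrow> complex) \<Rightarrow> 'a \<Rightarrow> complex" where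
  "spread \<phi> v = (if v \<in> nonreps then \<phi> v + \<phi> (rep v) else \<phi> v)"

definition unspread :: "('a \<Rightarrow> complex) \<Rightarrow> 'a \<Rightarrow> complex" where
  "unspread \<phi> v = (if v \<in> nonreps then \<phi> v - \<phi> (rep v) else \<phi> v)"

lemma nonreps_subset: "nonreps \<subseteq> recurrent" "nonreps \<subseteq> V"
  using recurrent_subset by (auto simp: nonreps_def)

lemma op_linear_spread: "op_linear spread" and op_linear_unspread: "op_linear unspread"
  unfolding op_linear_def spread_def unspread_def by (auto simp: fun_eq_iff algebra_simps)

lemma spread_in_ell2: "\<phi> \<in> ell2 V \<Longrightarrow> spread \<phi> \<in> ell2 V"
  using nonreps_subset by (auto simp: ell2_def spread_def)

text \<open>Representatives lie outside \<open>nonreps\<close>, so \<open>spread\<close> leaves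
  their values alone and \<open>unspread\<close> subtracts exactly what was added.\<close>

lemma unspread_spread: "unspread (spread \<phi>) = \<phi>"
  using rep_notin_nonreps nonreps_subset(1) by (auto simp: spread_def unspread_def fun_eq_iff)

text \<open>The set \<open>recurrent - nonreps\<close> consists of the representatives, the only
  vertices whose values get copied.\<close>

lemma spread_eq:
  assumes "\<And>v. v \<in> recurrent - nonreps \<Longrightarrow> \<phi> v = 0"
  shows "spread \<phi> = \<phi>"
  using assms rep_notin_nonreps rep_recurrent nonreps_subset(1)
  by (auto simp: spread_def fun_eq_iff)

text \<open>Here \<open>spread \<phi>\<close> is constant on each recurrent class, and arcs ending
  in such a class also start in it, so every difference in \<open>lap\<close> is 0. This supplies
  all zero blocks of the conjugated matrix.\<close>

lemma conjugated_lap_vanishes: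
  assumes "\<And>v. v \<in> nonreps \<Longrightarrow> \<phi> v = 0" "v \<in> recurrent"
  shows "unspread (lap (spread \<phi>)) v = 0"
proof -
  have spread: "spread \<phi> u = \<phi> (rep u)" if "u \<in> recurrent" for u
    using that assms(1) rep_fixed by (auto simp: spread_def)
  have "lap (spread \<phi>) u = 0" if u: "u \<in> recurrent" for u
  proof -
    have "spread \<phi> (src a) = spread \<phi> (tgt a)" if "a \<in> A" "tgt a = u" for a
      using that u spread src_recurrent rep_eq src_in_anc anc_refl by metis
    then show ?thesis unfolding lap_def by (auto intro!: sum.neutral)
  qed
  then show ?thesis using assms(2) rep_recurrent by (simp add: unspread_def)
qed

text \<open>In the order \<open>N\<close>, \<open>B\<close>, \<open>C\<close> the conjugated matrix
  is block upper triangular. The diagonal block of \<open>B\<close> is zero and contributes one root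
  0 per class, while the blocks of \<open>N\<close> and \<open>C\<close> are nonsingular.\<close>

theorem multiplicity_0_lap: "eigenvalue_multiplicity V lap 0 = card (anc ` recurrent)"
proof -
  define T where "T = unspread \<circ> (lap \<circ> spread)"
  define N B C where "N = V - recurrent" and "B = rep ` recurrent" and "C = nonreps"
  have V: "V = (N \<union> B) \<union> C"
    using recurrent_subset rep_recurrent by (auto simp: N_def B_def C_def nonreps_def)
  have fin: "finite N" "finite B" "finite C" using finite_V V by simp_all
  have disj: "N \<inter> B = {}" "(N \<union> B) \<inter> C = {}"
    using rep_recurrent by (auto simp: N_def B_def C_def nonreps_def)
  have BC: "B \<union> C = recurrent" using rep_recurrent by (auto simp: B_def C_def nonreps_def)
  have lin: "op_linear T"
    unfolding T_def by (intro op_linear_comp op_linear_unspread op_linear_lap op_linear_spread)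
  have zero: "T (point_mass x) y = 0" if "x \<in> N \<union> B" "y \<in> B \<union> C" for x y
    unfolding T_def o_def
    by (rule conjugated_lap_vanishes) (use that BC disj in \<open>auto simp: point_mass_def C_def\<close>)
  have "op_char_poly V lap = op_char_poly V T"
    unfolding T_def
    by (rule op_char_poly_conjugate[symmetric])
      (auto simp: finite_V op_linear_unspread op_linear_lap lap_in_ell2 spread_in_ell2 unspread_spread)
  also have "\<dots> = op_char_poly (N \<union> B) T * op_char_poly C T"
    unfolding V by (rule op_char_poly_union) (use fin disj zero in auto)
  also have "op_char_poly (N \<union> B) T = op_char_poly N T * op_char_poly B T"
    by (rule op_char_poly_union) (use fin disj zero in auto)
  also have "op_char_poly B T = [:0, 1:] ^ card B"
    by (rule op_char_poly_zero) (use fin zero in auto)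
  finally have poly: "op_char_poly V lap = op_char_poly N T * [:0, 1:] ^ card B * op_char_poly C T" .
  have N: "poly (op_char_poly N T) 0 \<noteq> 0"
  proof (rule op_char_poly_0_nonzero[OF fin(1) lin])
    fix \<phi> x assume \<phi>: "\<phi> \<in> ell2 N" and T0: "\<And>x. x \<in> N \<Longrightarrow> T \<phi> x = 0" and x: "x \<in> N"
    have \<phi>0: "\<phi> v = 0" if "v \<in> recurrent" for v using \<phi> that by (auto simp: ell2_def N_def)
    have "lap \<phi> v = 0" if "v \<in> V - recurrent" for v
    proof -
      have "v \<notin> nonreps" "spread \<phi> = \<phi>" using that nonreps_subset(1) spread_eq \<phi>0 by auto
      then show ?thesis using T0[of v] that by (simp add: T_def N_def unspread_def)
    qed
    then show "\<phi> x = 0" using harmonic_eq_0[of \<phi> x] \<phi>0 x by (auto simp: N_def)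
  qed
  \<comment> \<open>A function supported on \<open>C\<close> vanishes at the representatives, so
    \<open>spread\<close> fixes it. Then \<open>T \<phi> = 0\<close> on \<open>C\<close> says that
    \<open>lap \<phi>\<close> agrees at \<open>v\<close> and \<open>rep v\<close>, hence is constant
    on each class; so is \<open>\<phi>\<close>, with value 0 taken at the representative.\<close>
  have C: "poly (op_char_poly C T) 0 \<noteq> 0"
  proof (rule op_char_poly_0_nonzero[OF fin(3) lin])
    fix \<phi> x assume \<phi>: "\<phi> \<in> ell2 C" and T0: "\<And>x. x \<in> C \<Longrightarrow> T \<phi> x = 0" and x: "x \<in> C"
    have x': "x \<in> recurrent" using x nonreps_subset by (auto simp: C_def)
    have \<phi>0: "\<phi> v = 0" if "v \<notin> nonreps" for v using \<phi> that by (auto simp: ell2_def C_def)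
    have "lap \<phi> v = lap \<phi> (rep v)" if "v \<in> recurrent" for v
      using T0[of v] that spread_eq[of \<phi>] \<phi>0 rep_fixed[of v]
      by (cases "v \<in> nonreps") (auto simp: T_def C_def unspread_def)
    then have const: "lap \<phi> u = lap \<phi> x" if "u \<in> anc x" for u
      using that x' anc_recurrent rep_eq by metis
    have "\<phi> (rep x) = \<phi> x" by (rule const_if_lap_const[OF x' const rep_in_anc])
    then show "\<phi> x = 0" using \<phi>0[OF rep_notin_nonreps[OF x']] by simp
  qed
  have nz: "op_char_poly N T \<noteq> 0" "op_char_poly C T \<noteq> 0" using N C by auto
  then have "Polynomial.order 0 (op_char_poly V lap) = card B"
    using N C order_power_n_n[of 0 "card B"] by (simp add: poly order_mult order_0I)
  moreover have "op_char_poly V lap \<noteq> 0" using nz by (simp add: poly)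
  ultimately show ?thesis
    by (simp add: eigenvalue_multiplicity_def op_spectrum_def B_def card_rep)
qed

end


section \<open>Sources and sinks as closed classes\<close>

context weighted_digraph
begin

text \<open>Replaces components as subdigraphs by classes of mutual reachability, which can be
  compared with \<open>anc\<close>.\<close>

lemma is_scc_verts_iff: "(\<exists>H\<in>sccs. F = verts H) \<longleftrightarrow> (\<exists>v\<in>verts G. F = scc_of v)"
proof -
  have "(\<exists>H\<in>sccs. F = verts H) \<longleftrightarrow> F \<in> verts ` sccs" by blast
  also have "\<dots> \<longleftrightarrow> F \<in> scc_of ` verts G"
    by (simp only: sccs_verts_conv[symmetric] sccs_verts_conv_scc_of)
  finally show ?thesis by blast
qed

end

text \<open>The vertex weight in the denominator of the Laplacian is absorbed into the arc
  weight.\<close>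

sublocale weighted_digraph \<subseteq> inw: weighted_arcs "verts G" "arcs G" "tail G" "head G" "\<lambda>a. mA a / mV (head G a)"
  by unfold_locales (auto intro!: divide_pos_pos mA_pos mV_pos)

text \<open>With head and tail exchanged, \<open>anc v\<close> is the set of vertices reachable from
  \<open>v\<close>, and recurrent classes become sinks.\<close>

sublocale weighted_digraph \<subseteq> outw: weighted_arcs "verts G" "arcs G" "head G" "tail G" "\<lambda>a. mA a / mV (tail G a)"
  by unfold_locales (auto intro!: divide_pos_pos mA_pos mV_pos)

context weighted_digraph
begin

text \<open>Library reachability is confined to \<open>verts G\<close>. Checking the end vertex
  suffices: the start is either that vertex or the tail of an arc.\<close>

lemma reachable_iff_rtrancl:
  "u \<rightarrow>\<^sup>* v \<longleftrightarrow> v \<in> verts G \<and> (u, v) \<in> (arcs_ends G)\<^sup>*"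
proof
  assume "u \<rightarrow>\<^sup>* v"
  then show "v \<in> verts G \<and> (u, v) \<in> (arcs_ends G)\<^sup>*"
    using reachable_in_verts reachable_rtranclI by auto
next
  assume "v \<in> verts G \<and> (u, v) \<in> (arcs_ends G)\<^sup>*"
  then have v: "v \<in> verts G" and "(u, v) \<in> (arcs_ends G)\<^sup>*" by auto
  from this(2) show "u \<rightarrow>\<^sup>* v"
    by (induction rule: converse_rtrancl_induct) (use v in \<open>auto intro: adj_reachable_trans\<close>)
qed

lemma in_anc_iff: "v \<in> verts G \<Longrightarrow> u \<in> inw.anc v \<longleftrightarrow> u \<rightarrow>\<^sup>* v"
  by (simp add: inw.anc_def inw.edges_def reachable_iff_rtrancl arcs_ends_conv)

lemma out_anc_iff: "v \<in> verts G \<Longrightarrow> u \<in> outw.anc v \<longleftrightarrow> v \<rightarrow>\<^sup>* u"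
proof -
  assume v: "v \<in> verts G"
  have "outw.edges = (arcs_ends G)\<inverse>" by (auto simp: outw.edges_def arcs_ends_conv)
  then have "u \<in> outw.anc v \<longleftrightarrow> (v, u) \<in> (arcs_ends G)\<^sup>*"
    by (simp add: outw.anc_def rtrancl_converse)
  also have "\<dots> \<longleftrightarrow> v \<rightarrow>\<^sup>* u"
    using outw.anc_subset[OF v] calculation by (auto simp: reachable_iff_rtrancl)
  finally show ?thesis .
qed

text \<open>If no arc enters the component of \<open>v\<close>, backward induction puts
  \<open>anc v\<close> inside it, and the reverse inclusion always holds. Conversely, ancestors of a
  recurrent vertex are reached back, so they form its component, and \<open>anc\<close> is closed
  under predecessors.\<close>

lemma sources_eq: "sources G = inw.anc ` inw.recurrent"
proof (rule equalityI; rule subsetI)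
  fix F assume "F \<in> sources G"
  then obtain v where v: "v \<in> verts G" "F = scc_of v"
    and no: "\<And>a. a \<in> arcs G \<Longrightarrow> head G a \<in> F \<Longrightarrow> tail G a \<in> F"
    by (fastforce simp: sources_def is_scc_verts_iff)
  have F: "inw.anc v \<subseteq> F"
    using inw.anc_closed[OF _ _ no] in_scc_of_self[OF v(1)] v(2) by blast
  have "F = inw.anc v" using F v by (auto simp: scc_of_def in_anc_iff)
  moreover have "v \<in> inw.recurrent"
    using F v in_anc_iff inw.anc_subset[OF v(1)] by (auto simp: inw.recurrent_def scc_of_def)
  ultimately show "F \<in> inw.anc ` inw.recurrent" by blast
next
  fix F assume "F \<in> inw.anc ` inw.recurrent"
  then obtain v where v: "v \<in> inw.recurrent" "F = inw.anc v" by blast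
  then have vV: "v \<in> verts G" using inw.recurrent_subset by blast
  have "u \<in> F \<longleftrightarrow> u \<in> scc_of v" for u
    using v(2) in_anc_iff[OF vV] in_anc_iff[of u] inw.recurrentD[OF v(1)] reachable_in_verts
    unfolding scc_of_def mem_Collect_eq by metis
  then have "F = scc_of v" by blast
  then show "F \<in> sources G"
    using vV v(2) inw.src_in_anc by (auto simp: sources_def is_scc_verts_iff)
qed

lemma sinks_eq: "sinks G = outw.anc ` outw.recurrent"
proof (rule equalityI; rule subsetI)
  fix F assume "F \<in> sinks G"
  then obtain v where v: "v \<in> verts G" "F = scc_of v"
    and no: "\<And>a. a \<in> arcs G \<Longrightarrow> tail G a \<in> F \<Longrightarrow> head G a \<in> F"
    by (fastforce simp: sinks_def is_scc_verts_iff)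
  have F: "outw.anc v \<subseteq> F"
    using outw.anc_closed[OF _ _ no] in_scc_of_self[OF v(1)] v(2) by blast
  have "F = outw.anc v" using F v by (auto simp: scc_of_def out_anc_iff)
  moreover have "v \<in> outw.recurrent"
    using F v out_anc_iff outw.anc_subset[OF v(1)] by (auto simp: outw.recurrent_def scc_of_def)
  ultimately show "F \<in> outw.anc ` outw.recurrent" by blast
next
  fix F assume "F \<in> outw.anc ` outw.recurrent"
  then obtain v where v: "v \<in> outw.recurrent" "F = outw.anc v" by blast
  then have vV: "v \<in> verts G" using outw.recurrent_subset by blast
  have "u \<in> F \<longleftrightarrow> u \<in> scc_of v" for u
    using v(2) out_anc_iff[OF vV] out_anc_iff[of u] outw.recurrentD[OF v(1)] reachable_in_verts
    unfolding scc_of_def mem_Collect_eq by metis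
  then have "F = scc_of v" by blast
  then show "F \<in> sinks G"
    using vV v(2) outw.src_in_anc by (auto simp: sinks_def is_scc_verts_iff)
qed

section \<open>Transfer to the in- and out-Laplacian\<close>

lemma laplacian_plus_eq_lap:
  assumes "v \<in> verts G"
  shows "laplacian_plus G mV mA \<phi> v = inw.lap \<phi> v"
  unfolding laplacian_plus_explicit[OF assms] inw.lap_def sum_divide_distrib
  by (rule sum.cong) (auto simp: scaleR_conv_of_real)

lemma laplacian_minus_eq_lap:
  assumes "v \<in> verts G"
  shows "laplacian_minus G mV mA \<phi> v = outw.lap \<phi> v"
  unfolding laplacian_minus_explicit[OF assms] outw.lap_def sum_divide_distrib
  by (rule sum.cong) (auto simp: scaleR_conv_of_real)

lemma multiplicity_0_plus:
  "eigenvalue_multiplicity (verts G) (laplacian_plus G mV mA) 0 = card (sources G)"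
  using op_char_poly_cong[OF laplacian_plus_eq_lap finite_verts] inw.multiplicity_0_lap
  by (simp add: eigenvalue_multiplicity_def op_spectrum_def sources_eq)

lemma multiplicity_0_minus:
  "eigenvalue_multiplicity (verts G) (laplacian_minus G mV mA) 0 = card (sinks G)"
  using op_char_poly_cong[OF laplacian_minus_eq_lap finite_verts] outw.multiplicity_0_lap
  by (simp add: eigenvalue_multiplicity_def op_spectrum_def sinks_eq)

end

lemma ex1_iff_card_eq_1: "(\<exists>!x. x \<in> X) \<longleftrightarrow> card X = 1"
  by (auto simp: card_1_singleton_iff)

theorem theorem3p19:
  fixes G :: "('a, 'b) pre_digraph"
    and mV :: "'a \<Rightarrow> real" and mA :: "'b \<Rightarrow> real"
  assumes "weighted_digraph G mV mA"
  shows "((\<exists>!F. F \<in> sources G) \<longleftrightarrow> simple_eigenvalue (verts G) (laplacian_plus G mV mA) 0) \<and>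
    ((\<exists>!S. S \<in> sinks G) \<longleftrightarrow> simple_eigenvalue (verts G) (laplacian_minus G mV mA) 0) \<and>
    eigenvalue_multiplicity (verts G) (laplacian_plus G mV mA) 0 = card (sources G) \<and>
    eigenvalue_multiplicity (verts G) (laplacian_minus G mV mA) 0 = card (sinks G)"
proof -
  interpret weighted_digraph G mV mA by fact
  show ?thesis
    by (simp add: simple_eigenvalue_def multiplicity_0_plus multiplicity_0_minus ex1_iff_card_eq_1)
qed

end
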